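(* Suppose that $j_0\in J^{\infty}(i)$ for some $i\in I$ and $j_0\in J$. Then resetting $a_{ij_0}$ to zero is an equivalence operation.
   Context: Let $I=\{1,\dots,m\}$ and $J=\{1,\dots,n\}$ with $m,n\ge 1$. Let $A=(a_{ij})_{m\times n}$ be a matrix with entries in $[0,1]$ with $i$-th row $a_i$, and let $b=(b_i)_{m\times 1}$ be a vector with entries in $[0,1]$. Let $w\in(0,1)$ and $p>0$ be real numbers. For $x,y\in[0,1]$ put $\varphi(x,y)=\left(w x^{p}+(1-w)y^{p}\right)^{1/p}$ (weighted power mean). For $x\in[0,1]^n$ put $\varphi(a_i,x)=\max_{j\in J}\varphi(a_{ij},x_j)$, and let $S(A,b)=\{x\in[0,1]^n:\varphi(a_i,x)=b_i\ \forall i\in I\}$, the feasible set of the problem of minimizing $cx$ (for a given $c\in\mathbb{R}^n$) subject to $\varphi(a_i,x)=b_i$ ($i\in I$), $x\in[0,1]^n$. For $i\in I$ define $J^{\infty}(i)=\{j\in J: b_i^{p}\ge 1-w,\ a_{ij}<[(b_i^{p}+w-1)/w]^{1/p}\}$. Changing the value of an entry $a_{ij}$ of $A$ is called an equivalence operation if it has no effect on the solutions of the problem, i.e. if $S(A',b)=S(A,b)$, where $A'$ is the matrix obtained from $A$ by this change. *)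

theory Defs
  imports "HOL-Analysis.Analysis"
begin

text \<open>
  The index sets \<open>I = {1..m}\<close> and \<open>J = {1..n}\<close> are the finite (hence nonempty) types \<open>'m\<close> and
  \<open>'n\<close>. All bases of \<open>powr\<close> below are intended to be nonnegative; since \<open>0 powr a = 0\<close>,
  \<open>powr\<close> agrees there with the usual power for positive exponents.
\<close>

definition wpm :: "real \<Rightarrow> real \<Rightarrow> real \<Rightarrow> real \<Rightarrow> real" where
  "wpm w p x y = (w * x powr p + (1 - w) * y powr p) powr (1 / p)"

definition max_wpm :: "real \<Rightarrow> real \<Rightarrow> real ^ 'n \<Rightarrow> real ^ 'n \<Rightarrow> real" where
  "max_wpm w p a x = (MAX j\<in>UNIV. wpm w p (a $ j) (x $ j))"

definition feasible :: "real \<Rightarrow> real \<Rightarrow> real ^ 'n ^ 'm \<Rightarrow> real ^ 'm \<Rightarrow> (real ^ 'n) set" where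
  "feasible w p A b =
     {x. (\<forall>j. x $ j \<in> {0..1}) \<and> (\<forall>i. max_wpm w p (A $ i) x = b $ i)}"

definition J_inf :: "real \<Rightarrow> real \<Rightarrow> real ^ 'n ^ 'm \<Rightarrow> real ^ 'm \<Rightarrow> 'm \<Rightarrow> 'n set" where
  "J_inf w p A b i =
     {j. (b $ i) powr p \<ge> 1 - w \<and>
         A $ i $ j < (((b $ i) powr p + w - 1) / w) powr (1 / p)}"

definition set_entry :: "real ^ 'n ^ 'm \<Rightarrow> 'm \<Rightarrow> 'n \<Rightarrow> real \<Rightarrow> real ^ 'n ^ 'm" where
  "set_entry A i j v = (\<chi> k l. if k = i \<and> l = j then v else A $ k $ l)"

text \<open>Changing the entry of \<open>A\<close> at position \<open>(i, j)\<close> to \<open>v\<close> is an equivalence operation:\<close>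

definition equivalence_operation ::
  "real \<Rightarrow> real \<Rightarrow> real ^ 'n ^ 'm \<Rightarrow> real ^ 'm \<Rightarrow> 'm \<Rightarrow> 'n \<Rightarrow> real \<Rightarrow> bool" where
  "equivalence_operation w p A b i j v \<longleftrightarrow>
     feasible w p (set_entry A i j v) b = feasible w p A b"

end

theory Submission imports Defs begin

text \<open>
  Whatever value \<open>x\<^sub>j \<in> [0,1]\<close> takes, monotonicity gives
  \<open>\<phi>(a\<^sub>i\<^sub>j, x\<^sub>j) \<le> \<phi>(a\<^sub>i\<^sub>j, 1)\<close>, and the threshold in the definition of \<open>J\<^sup>\<infinity>(i)\<close> is precisely the
  solution \<open>t\<close> of \<open>\<phi>(t, 1) = b\<^sub>i\<close>. An entry below the threshold therefore contributes a term that
  is strictly less than \<open>b\<^sub>i\<close> (lemma \<open>wpm_less_if_below_threshold\<close>). Such a term neither violates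
  the equation \<open>max\<^sub>j \<phi>(a\<^sub>i\<^sub>j, x\<^sub>j) = b\<^sub>i\<close> nor helps to attain it. This remains so when the entry is
  lowered to zero, because zero is then below the threshold too; hence the equation holds for the
  same \<open>x\<close> before and after the change.
\<close>

lemma wpm_less_if_below_threshold:
  assumes "0 < w" "w < 1" "p > 0" "0 \<le> a" "0 \<le> y" "y \<le> 1" "0 \<le> \<beta>"
    and "1 - w \<le> \<beta> powr p"
    and below: "a < ((\<beta> powr p + w - 1) / w) powr (1 / p)"
  shows "wpm w p a y < \<beta>"
proof -
  have "a powr p < (((\<beta> powr p + w - 1) / w) powr (1 / p)) powr p"
    using assms by (intro powr_less_mono2) auto
  also have "\<dots> = (\<beta> powr p + w - 1) / w"
    using assms by (simp add: powr_powr)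
  finally have "w * a powr p < \<beta> powr p + w - 1"
    using \<open>0 < w\<close> by (simp add: field_simps)
  moreover have "(1 - w) * y powr p \<le> 1 - w"
    using assms by (simp add: mult_left_le powr_le1)
  ultimately have "w * a powr p + (1 - w) * y powr p < \<beta> powr p"
    by linarith
  then have "wpm w p a y < (\<beta> powr p) powr (1 / p)"
    unfolding wpm_def using assms by (intro powr_less_mono2) auto
  also have "\<dots> = \<beta>"
    using assms by (simp add: powr_powr)
  finally show ?thesis .
qed

lemma max_wpm_eq_iff:
  "max_wpm w p a x = \<beta> \<longleftrightarrow>
     (\<forall>j. wpm w p (a $ j) (x $ j) \<le> \<beta>) \<and> (\<exists>j. wpm w p (a $ j) (x $ j) = \<beta>)"
  unfolding max_wpm_def by (subst Max_eq_iff) auto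

text \<open>
  A maximum equals \<open>\<beta>\<close> iff \<open>\<beta>\<close> bounds all terms and is attained; a term strictly below \<open>\<beta>\<close>
  affects neither condition.
\<close>
lemma max_wpm_eq_cong:
  assumes "\<And>j. j \<noteq> j0 \<Longrightarrow> a' $ j = a $ j"
    and "wpm w p (a $ j0) (x $ j0) < \<beta>" "wpm w p (a' $ j0) (x $ j0) < \<beta>"
  shows "max_wpm w p a' x = \<beta> \<longleftrightarrow> max_wpm w p a x = \<beta>"
  unfolding max_wpm_eq_iff using assms by (metis less_imp_le less_irrefl)

theorem lemma4:
  fixes A :: "real ^ 'n ^ 'm" and b :: "real ^ 'm" and w p :: real
    and i :: 'm and j0 :: 'n
  assumes "\<And>k j. A $ k $ j \<in> {0..1}"
    and "\<And>k. b $ k \<in> {0..1}"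
    and "0 < w" and "w < 1" and "p > 0"
    and "j0 \<in> J_inf w p A b i"
  shows "equivalence_operation w p A b i j0 0"
proof -
  define T where "T = (((b $ i) powr p + w - 1) / w) powr (1 / p)"
  have level: "1 - w \<le> (b $ i) powr p" and below: "A $ i $ j0 < T"
    using assms(6) by (auto simp: J_inf_def T_def)
  have "0 \<le> A $ i $ j0" "0 \<le> b $ i"
    using assms(1)[of i j0] assms(2)[of i] by auto
  have less: "wpm w p a y < b $ i" if "0 \<le> a" "a < T" "y \<in> {0..1}" for a y
    using that assms(3-5) level \<open>0 \<le> b $ i\<close>
    by (intro wpm_less_if_below_threshold) (auto simp: T_def)
  have "max_wpm w p (set_entry A i j0 0 $ k) x = b $ k \<longleftrightarrow> max_wpm w p (A $ k) x = b $ k"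
    if x: "\<forall>j. x $ j \<in> {0..1}" for x k
  proof (cases "k = i")
    case True
    have "max_wpm w p (set_entry A i j0 0 $ i) x = b $ i \<longleftrightarrow> max_wpm w p (A $ i) x = b $ i"
    proof (rule max_wpm_eq_cong)
      show "wpm w p (A $ i $ j0) (x $ j0) < b $ i"
        using less below \<open>0 \<le> A $ i $ j0\<close> x by blast
      show "wpm w p (set_entry A i j0 0 $ i $ j0) (x $ j0) < b $ i"
        using less[of 0 "x $ j0"] below \<open>0 \<le> A $ i $ j0\<close> x by (simp add: set_entry_def)
    qed (simp add: set_entry_def)
    with True show ?thesis by simp
  next
    case False
    then have "set_entry A i j0 0 $ k = A $ k"
      by (simp add: set_entry_def vec_eq_iff)
    then show ?thesis by simp
  qed
  then show ?thesis
    unfolding equivalence_operation_def feasible_def by blast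
qed

end
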